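(* Assume the setting below. The following statements are equivalent: (1) the matrix $X$ is invertible; (2) there exist numbers $y_0,\dots,y_d$ with $\sum_{i=0}^d y_iA^iX=I$; (3) the linear system $\mathbf L$: $\sum_{i=0}^d \alpha_{0,i}y_i=1$, $\sum_{i=0}^d\alpha_{h,i}y_i=0$ for $1\le h\le d$, in unknowns $y_0,\dots,y_d$, has a solution; (4) the linear system $\mathbf M$: $\sum_{j=0}^d x_{j,0}z_j=1$, $\sum_{j=0}^d x_{j,h}z_j=0$ for $1\le h\le d$, in unknowns $z_0,\dots,z_d$, has a solution; (5) the matrix $P=(\alpha_{h,i})_{0\le h\le d,\,0\le i\le d}$ is invertible; (6) the matrix $Q$ is invertible; (7) $\det(P)\neq 0$; (8) $\det(Q)\neq 0$.
   Context: Setting: Let $d\ge 2$ and $k\ge 3$ be integers. Let numbers $c_i,a_i,b_i$ ($-1\le i\le d+1$) satisfy $c_{-1}=c_0=0$, $c_1=1$, $c_{d+1}=0$, $b_{-1}=0$, $b_0=k$, $b_d=b_{d+1}=0$, $a_0=0$, $k=c_i+a_i+b_i$ for all $-1\le i\le d+1$, $1=c_1\le c_2\le\cdots\le c_d\le k$ and $k=b_0\ge b_1\ge\cdots\ge b_{d-1}\ge 1$. Let $A_{-1}=\mathbf 0, A_0,A_1,\dots,A_d,A_{d+1}=\mathbf 0$ be $n\times n$ matrices with $A_0=I$, $A_1=A$, $A\mathbf j=k\mathbf j$ (where $\mathbf j$ is the all-ones column vector), the minimal polynomial of $A$ has degree at least $d+1$, $J=A_0+A_1+\cdots+A_d$ (with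 $J$ the all-ones matrix), and $AA_i=b_{i-1}A_{i-1}+a_iA_i+c_{i+1}A_{i+1}$ for $0\le i\le d$. Let $\{x_{i,j}: 0\le i\le d,\,-1\le j\le d+1\}$ be numbers with $x_{i,-1}=x_{i,d+1}=0$ for $0\le i\le d$ and $x_{i+1,j}=(x_{i,j+1}-x_{i,j})b_j-(x_{i,j}-x_{i,j-1})c_j$ for $0\le i\le d-1$, $0\le j\le d$ (the values $x_{0,j}$, $0\le j\le d$, are arbitrary). Let $X=\sum_{j=0}^d x_{0,j}A_j$. Let $Q=(x'_{i,j})_{0\le i,j\le d}$ with $x'_{i,j}=x_{j,i}$. Let $\alpha_{h,i}=\sum_{j=0}^i\binom{i}{j}k^{i-j}x_{j,h}$ for $0\le i,h\le d$. *)

theory Defs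
  imports Complex_Main "HOL-Computational_Algebra.Polynomial" "Jordan_Normal_Form.Determinant"
begin

text \<open>
  The type \<open>'a mat\<close> is not an instance of \<^class>\<open>comm_monoid_add\<close> (the zero matrix depends on the
  dimensions), so sums of \<open>n \<times> n\<close> matrices are taken in the module of these matrices.
\<close>

definition finsum_mat :: "nat \<Rightarrow> ('b \<Rightarrow> 'a :: field mat) \<Rightarrow> 'b set \<Rightarrow> 'a mat" where
  "finsum_mat n f S = finsum (module_mat TYPE('a) n n) f S"

lemma finsum_mat_carrier:
  fixes f :: "'b \<Rightarrow> 'a :: field mat"
  assumes "\<And>s. s \<in> S \<Longrightarrow> f s \<in> carrier_mat n n"
  shows "finsum_mat n f S \<in> carrier_mat n n"
proof -
  interpret abelian_group "module_mat TYPE('a) n n" by (rule abelian_group_mat)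
  show ?thesis unfolding finsum_mat_def
    using finsum_closed[of f S] assms by (auto simp: module_mat_simps)
qed

lemma index_finsum_mat:
  fixes f :: "'b \<Rightarrow> 'a :: field mat"
  assumes "finite S" "\<And>s. s \<in> S \<Longrightarrow> f s \<in> carrier_mat n n" "i < n" "j < n"
  shows "finsum_mat n f S $$ (i, j) = (\<Sum>s\<in>S. f s $$ (i, j))"
  using assms(1,2)
proof (induction S rule: finite_induct)
  case empty
  interpret abelian_group "module_mat TYPE('a) n n" by (rule abelian_group_mat)
  show ?case using assms(3,4) unfolding finsum_mat_def by (simp add: module_mat_simps)
next
  case (insert s S)
  interpret abelian_group "module_mat TYPE('a) n n" by (rule abelian_group_mat)
  have car: "f s \<in> carrier_mat n n" "finsum_mat n f S \<in> carrier_mat n n"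
    using insert.prems by (auto intro!: finsum_mat_carrier)
  have "finsum_mat n f (insert s S) = f s + finsum_mat n f S"
    unfolding finsum_mat_def using finsum_insert[OF insert.hyps, of f] insert.prems
    by (auto simp: module_mat_simps)
  then show ?case using insert car assms(3,4) by auto
qed

definition poly_mat :: "'a :: field poly \<Rightarrow> 'a mat \<Rightarrow> 'a mat" where
  "poly_mat p A = finsum_mat (dim_row A) (\<lambda>i. coeff p i \<cdot>\<^sub>m (A ^\<^sub>m i)) {0..degree p}"

definition is_min_poly :: "'a :: field mat \<Rightarrow> 'a poly \<Rightarrow> bool" where
  "is_min_poly A p \<longleftrightarrow>
     lead_coeff p = 1 \<and> poly_mat p A = 0\<^sub>m (dim_row A) (dim_row A) \<and>
     (\<forall>q. q \<noteq> 0 \<longrightarrow> poly_mat q A = 0\<^sub>m (dim_row A) (dim_row A) \<longrightarrow> degree p \<le> degree q)"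

definition min_poly :: "'a :: field mat \<Rightarrow> 'a poly" where
  "min_poly A = (THE p. is_min_poly A p)"

lemma poly_mat_carrier:
  assumes "A \<in> carrier_mat n n"
  shows "poly_mat p A \<in> carrier_mat n n"
proof -
  have "dim_row A = n" using assms by auto
  then show ?thesis unfolding poly_mat_def
    using assms by (auto intro!: finsum_mat_carrier pow_carrier_mat)
qed

lemma index_poly_mat:
  assumes A: "A \<in> carrier_mat n n" and ij: "i < n" "j < n" and N: "degree p \<le> N"
  shows "poly_mat p A $$ (i, j) = (\<Sum>t\<le>N. coeff p t * (A ^\<^sub>m t) $$ (i, j))"
proof -
  have dn: "dim_row A = n" using A by auto
  have car: "A ^\<^sub>m t \<in> carrier_mat n n" for t using A by (rule pow_carrier_mat)
  have dims: "dim_row (A ^\<^sub>m t) = n" "dim_col (A ^\<^sub>m t) = n" for t using car[of t] by auto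
  have "poly_mat p A $$ (i, j) = (\<Sum>t\<in>{0..degree p}. (coeff p t \<cdot>\<^sub>m (A ^\<^sub>m t)) $$ (i, j))"
    unfolding poly_mat_def dn by (rule index_finsum_mat) (use car ij in auto)
  also have "\<dots> = (\<Sum>t\<in>{0..degree p}. coeff p t * (A ^\<^sub>m t) $$ (i, j))"
    using dims ij by (intro sum.cong) auto
  also have "\<dots> = (\<Sum>t\<le>N. coeff p t * (A ^\<^sub>m t) $$ (i, j))"
    using N by (intro sum.mono_neutral_left) (auto intro: coeff_eq_0)
  finally show ?thesis .
qed

lemma poly_mat_eq_0_iff:
  assumes A: "A \<in> carrier_mat n n" and N: "degree p \<le> N"
  shows "poly_mat p A = 0\<^sub>m (dim_row A) (dim_row A) \<longleftrightarrow>
    (\<forall>i<n. \<forall>j<n. (\<Sum>t\<le>N. coeff p t * (A ^\<^sub>m t) $$ (i, j)) = 0)"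
proof -
  have dn: "dim_row A = n" using A by auto
  have "poly_mat p A = 0\<^sub>m n n \<longleftrightarrow> (\<forall>i<n. \<forall>j<n. poly_mat p A $$ (i, j) = 0)"
  proof
    assume "\<forall>i<n. \<forall>j<n. poly_mat p A $$ (i, j) = 0"
    then show "poly_mat p A = 0\<^sub>m n n"
      using poly_mat_carrier[OF A, of p] by (intro eq_matI) auto
  qed auto
  then show ?thesis using index_poly_mat[OF A _ _ N] dn by simp
qed

lemma ex_annihilating_poly:
  fixes A :: "'a :: field mat"
  assumes A: "A \<in> carrier_mat n n"
  shows "\<exists>q. q \<noteq> 0 \<and> poly_mat q A = 0\<^sub>m (dim_row A) (dim_row A)"
proof -
  define N where "N = n * n"
  define M where "M = mat (Suc N) (Suc N)
    (\<lambda>(r, t). if r < N then (A ^\<^sub>m t) $$ (r div n, r mod n) else 0)"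
  have M: "M \<in> carrier_mat (Suc N) (Suc N)" unfolding M_def by auto
  have "M $$ (N, t) = 0" if "t < Suc N" for t using that by (simp add: M_def)
  then have "det M = 0" using laplace_expansion_row[OF M, of N] by simp
  then obtain v where v: "v \<in> carrier_vec (Suc N)" "v \<noteq> 0\<^sub>v (Suc N)" "M *\<^sub>v v = 0\<^sub>v (Suc N)"
    using det_0_iff_vec_prod_zero_field[OF M] by auto
  define q where "q = Poly (list_of_vec v)"
  have coeff_q: "coeff q t = (if t < Suc N then v $ t else 0)" for t
    using v(1) by (auto simp: q_def coeff_Poly_eq nth_default_def list_of_vec_index)
  have "q \<noteq> 0"
  proof
    assume "q = 0"
    then have "v $ t = 0" if "t < Suc N" for t using coeff_q[of t] that by simp
    then have "v = 0\<^sub>v (Suc N)" using v(1) by (intro eq_vecI) auto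
    with v(2) show False by simp
  qed
  moreover have deg: "degree q \<le> N" by (rule degree_le) (auto simp: coeff_q)
  have "(\<Sum>t\<le>N. coeff q t * (A ^\<^sub>m t) $$ (i, j)) = 0" if ij: "i < n" "j < n" for i j
  proof -
    define r where "r = i * n + j"
    have "i * n + n \<le> n * n" using ij(1) mult_le_mono1[of "Suc i" n n] by simp
    then have r: "r < N" "r div n = i" "r mod n = j" using ij by (auto simp: r_def N_def)
    have "0 = (M *\<^sub>v v) $ r" using v r by simp
    also have "\<dots> = (\<Sum>t<Suc N. (A ^\<^sub>m t) $$ (i, j) * v $ t)"
      using v(1) r by (auto simp: M_def scalar_prod_def atLeast0LessThan intro!: sum.cong)
    also have "\<dots> = (\<Sum>t\<le>N. coeff q t * (A ^\<^sub>m t) $$ (i, j))"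
      unfolding lessThan_Suc_atMost by (intro sum.cong) (auto simp: coeff_q)
    finally show ?thesis by simp
  qed
  ultimately show ?thesis using poly_mat_eq_0_iff[OF A deg] by blast
qed

lemma is_min_poly_unique:
  assumes A: "A \<in> carrier_mat n n" and p: "is_min_poly A p" and q: "is_min_poly A q"
  shows "p = q"
proof (rule ccontr)
  assume ne: "p \<noteq> q"
  have nz: "p \<noteq> 0" "q \<noteq> 0" using p q by (auto simp: is_min_poly_def)
  have deg: "degree p = degree q"
    using p q nz unfolding is_min_poly_def by (intro antisym) auto
  have "degree (p - q) \<le> degree p" using deg by (intro degree_diff_le) auto
  moreover have "coeff (p - q) (degree p) = 0"
    using p q deg by (simp add: is_min_poly_def)
  ultimately have "degree (p - q) < degree p"
    using ne by (metis eq_iff_diff_eq_0 leading_coeff_0_iff order_le_imp_less_or_eq)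
  moreover have "poly_mat (p - q) A = 0\<^sub>m (dim_row A) (dim_row A)"
    using p q poly_mat_eq_0_iff[OF A, of p "degree p"] poly_mat_eq_0_iff[OF A, of q "degree p"]
      poly_mat_eq_0_iff[OF A \<open>degree (p - q) \<le> degree p\<close>] deg
    by (simp add: is_min_poly_def left_diff_distrib sum_subtractf)
  ultimately show False using p ne unfolding is_min_poly_def
    by (metis leD right_minus_eq)
qed

lemma is_min_poly_min_poly:
  assumes A: "A \<in> carrier_mat n n"
  shows "is_min_poly A (min_poly A)"
proof -
  let ?P = "\<lambda>q. q \<noteq> 0 \<and> poly_mat q A = 0\<^sub>m (dim_row A) (dim_row A)"
  obtain q where q: "?P q" "\<And>r. ?P r \<Longrightarrow> degree q \<le> degree r"
    using ex_has_least_nat[of ?P _ degree] ex_annihilating_poly[OF A] by metis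
  define p where "p = smult (inverse (lead_coeff q)) q"
  have deg: "degree p = degree q" using q(1) by (simp add: p_def)
  have "lead_coeff p = 1" using q(1) by (simp add: p_def)
  moreover have "poly_mat p A = 0\<^sub>m (dim_row A) (dim_row A)"
    using q(1) poly_mat_eq_0_iff[OF A, of q "degree q"] poly_mat_eq_0_iff[OF A, of p "degree q"] deg
    by (simp add: p_def mult.assoc flip: sum_distrib_left)
  ultimately have "is_min_poly A p" using q(2) deg by (auto simp: is_min_poly_def)
  then show ?thesis unfolding min_poly_def
    using is_min_poly_unique[OF A] by (metis (mono_tags, lifting) theI)
qed

definition all_equivalent :: "bool list \<Rightarrow> bool" where
  "all_equivalent Ss \<longleftrightarrow> (\<forall>S\<in>set Ss. \<forall>T\<in>set Ss. S \<longleftrightarrow> T)"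

end

theory Submission
  imports Defs
begin

text \<open>
  The three-term recurrence turns multiplication by \<open>A\<close> on \<open>\<Sum>\<^sub>j f\<^sub>j A\<^sub>j\<close> into an operator on the
  coefficients, and on the rows \<open>x\<^sub>i\<close> that operator is \<open>x\<^sub>i \<mapsto> k x\<^sub>i + x\<^sub>i\<^sub>+\<^sub>1\<close>. Hence the coefficients of
  \<open>A\<^sup>i X\<close> with respect to \<open>A\<^sub>0, \<dots>, A\<^sub>d\<close> form the \<open>i\<close>-th column of \<open>P\<close>, so a solution of system \<open>L\<close> gives
  an inverse of \<open>X\<close>. Conversely, if \<open>X\<close> is invertible, a kernel vector of \<open>P\<close> gives a polynomial of
  degree at most \<open>d\<close> annihilating \<open>A\<close>, so \<open>P\<close> is injective. Finally \<open>P = Q U\<close> with \<open>U\<close> the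
  unitriangular matrix of entries \<open>binomial(i, j) k\<^sup>i\<^sup>-\<^sup>j\<close>, which transfers everything to \<open>Q\<close> and system \<open>M\<close>.
\<close>

section \<open>Sums of square matrices, invertibility over a field, and powers below the minimal
  degree\<close>

lemma mult_finsum_mat:
  fixes f :: "'b \<Rightarrow> 'a :: field mat"
  assumes "finite S" and A: "A \<in> carrier_mat n n" and f: "\<And>s. s \<in> S \<Longrightarrow> f s \<in> carrier_mat n n"
  shows "A * finsum_mat n f S = finsum_mat n (\<lambda>s. A * f s) S"
proof (rule eq_matI)
  have car: "finsum_mat n f S \<in> carrier_mat n n" "finsum_mat n (\<lambda>s. A * f s) S \<in> carrier_mat n n"
    using A f by (auto intro!: finsum_mat_carrier)
  then show "dim_row (A * finsum_mat n f S) = dim_row (finsum_mat n (\<lambda>s. A * f s) S)"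
    "dim_col (A * finsum_mat n f S) = dim_col (finsum_mat n (\<lambda>s. A * f s) S)"
    using A by auto
  fix i j assume "i < dim_row (finsum_mat n (\<lambda>s. A * f s) S)" "j < dim_col (finsum_mat n (\<lambda>s. A * f s) S)"
  then have ij: "i < n" "j < n" using car by auto
  have "(A * finsum_mat n f S) $$ (i, j) = (\<Sum>t<n. A $$ (i, t) * (\<Sum>s\<in>S. f s $$ (t, j)))"
    using A car ij assms by (simp add: scalar_prod_def index_finsum_mat atLeast0LessThan)
  also have "\<dots> = (\<Sum>s\<in>S. \<Sum>t<n. A $$ (i, t) * f s $$ (t, j))"
    unfolding sum_distrib_left by (rule sum.swap)
  also have "\<dots> = (\<Sum>s\<in>S. (A * f s) $$ (i, j))"
  proof (rule sum.cong[OF refl])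
    fix s assume "s \<in> S"
    then show "(\<Sum>t<n. A $$ (i, t) * f s $$ (t, j)) = (A * f s) $$ (i, j)"
      using A f[of s] ij by (simp add: scalar_prod_def atLeast0LessThan)
  qed
  also have "\<dots> = finsum_mat n (\<lambda>s. A * f s) S $$ (i, j)"
    by (rule index_finsum_mat[symmetric]) (use assms ij in auto)
  finally show "(A * finsum_mat n f S) $$ (i, j) = finsum_mat n (\<lambda>s. A * f s) S $$ (i, j)" .
qed

lemma finsum_mat_mult:
  fixes f :: "'b \<Rightarrow> 'a :: field mat"
  assumes "finite S" and A: "A \<in> carrier_mat n n" and f: "\<And>s. s \<in> S \<Longrightarrow> f s \<in> carrier_mat n n"
  shows "finsum_mat n f S * A = finsum_mat n (\<lambda>s. f s * A) S"
proof (rule eq_matI)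
  have car: "finsum_mat n f S \<in> carrier_mat n n" "finsum_mat n (\<lambda>s. f s * A) S \<in> carrier_mat n n"
    using A f by (auto intro!: finsum_mat_carrier intro: mult_carrier_mat[of _ n n])
  then show "dim_row (finsum_mat n f S * A) = dim_row (finsum_mat n (\<lambda>s. f s * A) S)"
    "dim_col (finsum_mat n f S * A) = dim_col (finsum_mat n (\<lambda>s. f s * A) S)"
    using A by auto
  fix i j assume "i < dim_row (finsum_mat n (\<lambda>s. f s * A) S)" "j < dim_col (finsum_mat n (\<lambda>s. f s * A) S)"
  then have ij: "i < n" "j < n" using car by auto
  have "(finsum_mat n f S * A) $$ (i, j) = (\<Sum>t<n. (\<Sum>s\<in>S. f s $$ (i, t)) * A $$ (t, j))"
    using A car ij assms by (simp add: scalar_prod_def index_finsum_mat atLeast0LessThan)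
  also have "\<dots> = (\<Sum>s\<in>S. \<Sum>t<n. f s $$ (i, t) * A $$ (t, j))"
    unfolding sum_distrib_right by (rule sum.swap)
  also have "\<dots> = (\<Sum>s\<in>S. (f s * A) $$ (i, j))"
  proof (rule sum.cong[OF refl])
    fix s assume "s \<in> S"
    then show "(\<Sum>t<n. f s $$ (i, t) * A $$ (t, j)) = (f s * A) $$ (i, j)"
      using A f[of s] ij by (simp add: scalar_prod_def atLeast0LessThan)
  qed
  also have "\<dots> = finsum_mat n (\<lambda>s. f s * A) S $$ (i, j)"
    by (rule index_finsum_mat[symmetric]) (use assms ij in \<open>auto intro: mult_carrier_mat[of _ n n]\<close>)
  finally show "(finsum_mat n f S * A) $$ (i, j) = finsum_mat n (\<lambda>s. f s * A) S $$ (i, j)" .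
qed

text \<open>\<open>invertible_mat\<close> leaves the dimensions of the inverse open; they are forced
  by the two product equations, the columns by \<open>M * N\<close> and the rows by
  \<open>N * M\<close>.\<close>

lemma invertible_mat_right_inverse:
  fixes M :: "'a :: semiring_1 mat"
  assumes "invertible_mat M" and M: "M \<in> carrier_mat n n"
  obtains N where "N \<in> carrier_mat n n" "M * N = 1\<^sub>m n"
proof -
  obtain N where N: "M * N = 1\<^sub>m n" "N * M = 1\<^sub>m (dim_row N)"
    using assms by (auto simp: invertible_mat_def inverts_mat_def)
  then have "dim_col N = n" "dim_row N = n"
    using M by (metis carrier_matD(2) index_mult_mat(3) index_one_mat(3))+
  then show ?thesis using that N(1) by auto
qed

lemma invertible_mat_iff_det:
  fixes M :: "'a :: field mat"
  assumes M: "M \<in> carrier_mat n n"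
  shows "invertible_mat M \<longleftrightarrow> det M \<noteq> 0"
proof
  assume "invertible_mat M"
  then obtain N where "N \<in> carrier_mat n n" "M * N = 1\<^sub>m n"
    using M by (rule invertible_mat_right_inverse)
  then have "det M * det N = 1" using M by (metis det_mult det_one)
  then show "det M \<noteq> 0" by auto
next
  assume "det M \<noteq> 0"
  then have "M \<in> Units (ring_mat TYPE('a) n ())" by (rule det_non_zero_imp_unit[OF M])
  then show "invertible_mat M"
    using M by (auto simp: Units_def ring_mat_simps invertible_mat_def inverts_mat_def)
qed

text \<open>The coefficients \<open>v\<close> form a polynomial of degree at most \<open>d\<close>
  that annihilates \<open>A\<close>. Its degree is below that of the minimal polynomial, so it is
  zero. This is the linear independence of the powers of \<open>A\<close> up to exponent
  \<open>d\<close>.\<close>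

lemma min_poly_degree_independent:
  fixes A :: "'a :: field mat"
  assumes A: "A \<in> carrier_mat n n" and deg: "degree (min_poly A) \<ge> d + 1"
    and v: "finsum_mat n (\<lambda>i. v i \<cdot>\<^sub>m (A ^\<^sub>m i)) {0..d} = 0\<^sub>m n n" and "i \<le> d"
  shows "v i = 0"
proof -
  define q where "q = Poly (map v [0..<Suc d])"
  have coeff_q: "coeff q t = (if t \<le> d then v t else 0)" for t
    by (simp add: q_def coeff_Poly_eq nth_default_def del: upt_Suc)
  have dq: "degree q \<le> d" by (rule degree_le) (auto simp: coeff_q)
  have "(\<Sum>t\<le>d. coeff q t * (A ^\<^sub>m t) $$ (r, s)) = 0" if "r < n" "s < n" for r s
  proof -
    have "(\<Sum>t\<le>d. coeff q t * (A ^\<^sub>m t) $$ (r, s))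
      = (\<Sum>t\<in>{0..d}. (v t \<cdot>\<^sub>m (A ^\<^sub>m t)) $$ (r, s))"
      using that A by (intro sum.cong) (auto simp: coeff_q)
    also have "\<dots> = finsum_mat n (\<lambda>i. v i \<cdot>\<^sub>m (A ^\<^sub>m i)) {0..d} $$ (r, s)"
      by (rule index_finsum_mat[symmetric]) (use A that in auto)
    finally show ?thesis using v that by simp
  qed
  then have "poly_mat q A = 0\<^sub>m (dim_row A) (dim_row A)"
    using poly_mat_eq_0_iff[OF A dq] by blast
  then have "q = 0"
    using is_min_poly_min_poly[OF A] deg dq unfolding is_min_poly_def by fastforce
  then show ?thesis using coeff_q[of i] \<open>i \<le> d\<close> by simp
qed

section \<open>Summation by parts for tridiagonal operators, and binomial transforms\<close>

lemma sum_int_shift: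
  fixes F :: "int \<Rightarrow> 'a :: ab_group_add"
  shows "(\<Sum>j\<in>{0..d}. F (int j + 1)) = (\<Sum>j\<in>{0..d}. F (int j)) + F (int d + 1) - F 0"
  by (induction d) (auto simp: algebra_simps)

text \<open>Summation by parts: shifting the index moves the tridiagonal operator from
  \<open>g\<close> to its transpose on \<open>f\<close>. Both shifts leave terms at the ends, and
  each of these carries one of the four vanishing boundary coefficients, whatever \<open>f\<close>
  and \<open>g\<close> are there.\<close>

lemma sum_tridiagonal_transpose:
  fixes f g a b c :: "int \<Rightarrow> 'a :: comm_ring"
  assumes "b (-1) = 0" "b (int d) = 0" "c 0 = 0" "c (int d + 1) = 0"
  shows "(\<Sum>j\<in>{0..d}. f (int j) *
      (b (int j - 1) * g (int j - 1) + a (int j) * g (int j) + c (int j + 1) * g (int j + 1)))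
    = (\<Sum>j\<in>{0..d}. (b (int j) * f (int j + 1) + a (int j) * f (int j) + c (int j) * f (int j - 1)) *
      g (int j))"
proof -
  have 1: "(\<Sum>j\<in>{0..d}. b (int j) * f (int j + 1) * g (int j))
      = (\<Sum>j\<in>{0..d}. b (int j - 1) * f (int j) * g (int j - 1))"
    using sum_int_shift[of "\<lambda>j. b (j - 1) * f j * g (j - 1)" d] assms by simp
  have 2: "(\<Sum>j\<in>{0..d}. c (int j + 1) * f (int j) * g (int j + 1))
      = (\<Sum>j\<in>{0..d}. c (int j) * f (int j - 1) * g (int j))"
    using sum_int_shift[of "\<lambda>j. c j * f (j - 1) * g j" d] assms by simp
  show ?thesis using 1 2 by (simp add: algebra_simps sum.distrib)
qed

text \<open>Pascal's rule. It is the induction step for expanding the \<open>i\<close>-th power of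
  \<open>q\<close> plus the shift that sends \<open>u j\<close> to \<open>u (Suc j)\<close>.\<close>

lemma sum_binomial_Suc:
  fixes u :: "nat \<Rightarrow> 'a :: comm_ring_1"
  shows "(\<Sum>j=0..Suc i. of_nat (Suc i choose j) * q ^ (Suc i - j) * u j)
    = (\<Sum>j=0..i. of_nat (i choose j) * q ^ (i - j) * (q * u j + u (Suc j)))"
proof -
  \<comment> \<open>The added term \<open>j = Suc i\<close> vanishes with its binomial coefficient.
    Splitting off \<open>j = 0\<close> then aligns the rest with the \<open>u (Suc j)\<close>
    terms.\<close>
  have "(\<Sum>j=0..i. of_nat (i choose j) * q ^ (Suc i - j) * u j)
    = (\<Sum>j=0..Suc i. of_nat (i choose j) * q ^ (Suc i - j) * u j)"
    by (simp add: binomial_eq_0)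
  also have "\<dots> = q ^ Suc i * u 0 + (\<Sum>j=0..i. of_nat (i choose Suc j) * q ^ (i - j) * u (Suc j))"
    by (subst sum.atLeast0_atMost_Suc_shift) simp
  finally have 1: "(\<Sum>j=0..i. of_nat (i choose j) * q ^ (Suc i - j) * u j)
    = q ^ Suc i * u 0 + (\<Sum>j=0..i. of_nat (i choose Suc j) * q ^ (i - j) * u (Suc j))" .
  have "(\<Sum>j=0..i. of_nat (i choose j) * q ^ (i - j) * (q * u j + u (Suc j)))
    = (\<Sum>j=0..i. of_nat (i choose j) * q ^ (Suc i - j) * u j)
      + (\<Sum>j=0..i. of_nat (i choose j) * q ^ (i - j) * u (Suc j))"
    unfolding sum.distrib[symmetric]
    by (intro sum.cong) (auto simp: algebra_simps Suc_diff_le)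
  also have "\<dots> = q ^ Suc i * u 0 + (\<Sum>j=0..i. of_nat (Suc i choose Suc j) * q ^ (i - j) * u (Suc j))"
    unfolding 1 by (simp add: algebra_simps sum.distrib)
  also have "\<dots> = (\<Sum>j=0..Suc i. of_nat (Suc i choose j) * q ^ (Suc i - j) * u j)"
    by (subst sum.atLeast0_atMost_Suc_shift) simp
  finally show ?thesis by simp
qed

text \<open>Below the diagonal the binomial coefficient has a lower index exceeding the upper one,
  so the matrix is upper triangular; its diagonal entries are 1.\<close>

lemma det_binomial_mat:
  "det (mat n n (\<lambda>(j, i). of_nat (i choose j) * q ^ (i - j))) = (1 :: 'a :: comm_ring_1)"
proof -
  let ?U = "mat n n (\<lambda>(j, i). of_nat (i choose j) * q ^ (i - j)) :: 'a mat"
  have "det ?U = prod_list (diag_mat ?U)"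
    by (rule det_upper_triangular[of _ n]) (auto simp: upper_triangular_def binomial_eq_0)
  then show ?thesis by (simp add: prod_list_diag_prod)
qed

theorem theorem2:
  fixes d k n :: nat
    and c a b :: "int \<Rightarrow> real"
    and As :: "int \<Rightarrow> 'a :: real_field mat"
    and A X P Q :: "'a mat"
    and x :: "nat \<Rightarrow> int \<Rightarrow> 'a"
    and \<alpha> :: "nat \<Rightarrow> nat \<Rightarrow> 'a"
  assumes d: "d \<ge> 2" and k: "k \<ge> 3"
    and c_bdry: "c (-1) = 0" "c 0 = 0" "c 1 = 1" "c (int d + 1) = 0"
    and b_bdry: "b (-1) = 0" "b 0 = real k" "b (int d) = 0" "b (int d + 1) = 0"
    and a0: "a 0 = 0"
    and cab: "\<And>i. -1 \<le> i \<Longrightarrow> i \<le> int d + 1 \<Longrightarrow> real k = c i + a i + b i"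
    and c_mono: "\<And>i. 1 \<le> i \<Longrightarrow> i < int d \<Longrightarrow> c i \<le> c (i + 1)" and c_le: "c (int d) \<le> real k"
    and b_mono: "\<And>i. 0 \<le> i \<Longrightarrow> i < int d - 1 \<Longrightarrow> b (i + 1) \<le> b i" and b_ge: "b (int d - 1) \<ge> 1"
    and As_carrier: "\<And>i. -1 \<le> i \<Longrightarrow> i \<le> int d + 1 \<Longrightarrow> As i \<in> carrier_mat n n"
    and As_bdry: "As (-1) = 0\<^sub>m n n" "As 0 = 1\<^sub>m n" "As 1 = A" "As (int d + 1) = 0\<^sub>m n n"
    and A_regular: "A *\<^sub>v vec n (\<lambda>_. 1) = of_nat k \<cdot>\<^sub>v vec n (\<lambda>_. 1)"
    and A_min_poly: "degree (min_poly A) \<ge> d + 1"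
    and As_sum: "mat n n (\<lambda>_. 1) = finsum_mat n (\<lambda>i. As (int i)) {0..d}"
    and As_rec: "\<And>i. 0 \<le> i \<Longrightarrow> i \<le> int d \<Longrightarrow>
      A * As i = of_real (b (i - 1)) \<cdot>\<^sub>m As (i - 1) + of_real (a i) \<cdot>\<^sub>m As i
        + of_real (c (i + 1)) \<cdot>\<^sub>m As (i + 1)"
    and x_bdry: "\<And>i. i \<le> d \<Longrightarrow> x i (-1) = 0" "\<And>i. i \<le> d \<Longrightarrow> x i (int d + 1) = 0"
    and x_rec: "\<And>i j. i < d \<Longrightarrow> 0 \<le> j \<Longrightarrow> j \<le> int d \<Longrightarrow>
      x (i + 1) j = (x i (j + 1) - x i j) * of_real (b j) - (x i j - x i (j - 1)) * of_real (c j)"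
    and X: "X = finsum_mat n (\<lambda>j. x 0 (int j) \<cdot>\<^sub>m As (int j)) {0..d}"
    and Q: "Q = mat (d + 1) (d + 1) (\<lambda>(i, j). x j (int i))"
    and \<alpha>: "\<And>h i. h \<le> d \<Longrightarrow> i \<le> d \<Longrightarrow>
      \<alpha> h i = (\<Sum>j=0..i. of_nat (i choose j) * of_nat k ^ (i - j) * x j (int h))"
    and P: "P = mat (d + 1) (d + 1) (\<lambda>(h, i). \<alpha> h i)"
  shows "all_equivalent
    [invertible_mat X,
     \<exists>y :: nat \<Rightarrow> 'a. finsum_mat n (\<lambda>i. y i \<cdot>\<^sub>m ((A ^\<^sub>m i) * X)) {0..d} = 1\<^sub>m n,
     \<exists>y :: nat \<Rightarrow> 'a. (\<Sum>i=0..d. \<alpha> 0 i * y i) = 1 \<and> (\<forall>h\<in>{1..d}. (\<Sum>i=0..d. \<alpha> h i * y i) = 0),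
     \<exists>z :: nat \<Rightarrow> 'a. (\<Sum>j=0..d. x j 0 * z j) = 1 \<and> (\<forall>h\<in>{1..d}. (\<Sum>j=0..d. x j (int h) * z j) = 0),
     invertible_mat P,
     invertible_mat Q,
     det P \<noteq> 0,
     det Q \<noteq> 0]"
proof -

  \<comment> \<open>Expansions in the matrices \<open>As j\<close> and the action of
    \<open>A\<close> on their coefficients\<close>
  define E where "E f = finsum_mat n (\<lambda>j. f (int j) \<cdot>\<^sub>m As (int j)) {0..d}" for f :: "int \<Rightarrow> 'a"
  \<comment> \<open>The transpose of the recurrence for \<open>As\<close>: here \<open>b j\<close>
    goes with \<open>f (j + 1)\<close> and \<open>c j\<close> with \<open>f (j - 1)\<close>. For
    \<open>j\<close> in 0..d the values of \<open>f\<close> outside this range enter only with the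
    factors \<open>c 0\<close> and \<open>b (int d)\<close>, which are zero.\<close>
  define L where "L f j = of_real (b j) * f (j + 1) + of_real (a j) * f j + of_real (c j) * f (j - 1)"
    for f :: "int \<Rightarrow> 'a" and j
  define U :: "'a mat" where
    "U = mat (d + 1) (d + 1) (\<lambda>(j, i). of_nat (i choose j) * of_nat k ^ (i - j))"
  have A: "A \<in> carrier_mat n n" using As_carrier[of 1] As_bdry(3) by simp
  have AsC: "As (int j) \<in> carrier_mat n n" if "j \<in> {0..d}" for j
    using As_carrier[of "int j"] that by simp
  have EC: "E f \<in> carrier_mat n n" for f
    unfolding E_def using AsC by (intro finsum_mat_carrier) auto
  have X_E: "X = E (x 0)" by (simp add: X E_def)
  have XC: "X \<in> carrier_mat n n" using EC X_E by simp
  have carriers: "P \<in> carrier_mat (d + 1) (d + 1)" "Q \<in> carrier_mat (d + 1) (d + 1)"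
    "U \<in> carrier_mat (d + 1) (d + 1)" by (auto simp: P Q U_def)
  have index_E: "E f $$ (r, s) = (\<Sum>j\<in>{0..d}. f (int j) * As (int j) $$ (r, s))"
    if "r < n" "s < n" for f r s
  proof -
    have "E f $$ (r, s) = (\<Sum>j\<in>{0..d}. (f (int j) \<cdot>\<^sub>m As (int j)) $$ (r, s))"
      unfolding E_def by (rule index_finsum_mat) (use AsC that in auto)
    also have "\<dots> = (\<Sum>j\<in>{0..d}. f (int j) * As (int j) $$ (r, s))"
      using AsC that by (intro sum.cong refl index_smult_mat) fastforce+
    finally show ?thesis .
  qed
  have A_mult_E: "A * E f = E (L f)" for f
  proof (rule eq_matI)
    show "dim_row (A * E f) = dim_row (E (L f))" "dim_col (A * E f) = dim_col (E (L f))"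
      using A EC[of f] EC[of "L f"] by auto
    fix r s assume "r < dim_row (E (L f))" "s < dim_col (E (L f))"
    then have rs: "r < n" "s < n" using EC[of "L f"] by auto
    have "(A * E f) $$ (r, s) = finsum_mat n (\<lambda>j. A * (f (int j) \<cdot>\<^sub>m As (int j))) {0..d} $$ (r, s)"
      unfolding E_def using A AsC by (subst mult_finsum_mat) auto
    also have "\<dots> = (\<Sum>j\<in>{0..d}. (A * (f (int j) \<cdot>\<^sub>m As (int j))) $$ (r, s))"
      using A AsC rs by (intro index_finsum_mat) auto
    also have "\<dots> = (\<Sum>j\<in>{0..d}. f (int j) * (of_real (b (int j - 1)) * As (int j - 1) $$ (r, s)
      + of_real (a (int j)) * As (int j) $$ (r, s) + of_real (c (int j + 1)) * As (int j + 1) $$ (r, s)))"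
    proof (rule sum.cong[OF refl])
      fix j assume j: "j \<in> {0..d}"
      have C: "As (int j) \<in> carrier_mat n n" "As (int j - 1) \<in> carrier_mat n n"
        "As (int j + 1) \<in> carrier_mat n n" using As_carrier j by auto
      have "A * (f (int j) \<cdot>\<^sub>m As (int j)) = f (int j) \<cdot>\<^sub>m (A * As (int j))"
        using A C by (intro mult_smult_distrib)
      also have "\<dots> = f (int j) \<cdot>\<^sub>m (of_real (b (int j - 1)) \<cdot>\<^sub>m As (int j - 1)
        + of_real (a (int j)) \<cdot>\<^sub>m As (int j) + of_real (c (int j + 1)) \<cdot>\<^sub>m As (int j + 1))"
        using j by (subst As_rec) auto
      finally show "(A * (f (int j) \<cdot>\<^sub>m As (int j))) $$ (r, s)
        = f (int j) * (of_real (b (int j - 1)) * As (int j - 1) $$ (r, s)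
          + of_real (a (int j)) * As (int j) $$ (r, s) + of_real (c (int j + 1)) * As (int j + 1) $$ (r, s))"
        using C rs by simp
    qed
    also have "\<dots> = (\<Sum>j\<in>{0..d}. L f (int j) * As (int j) $$ (r, s))"
      unfolding L_def by (rule sum_tridiagonal_transpose) (simp_all add: b_bdry c_bdry)
    also have "\<dots> = E (L f) $$ (r, s)" using rs by (simp add: index_E)
    finally show "(A * E f) $$ (r, s) = E (L f) $$ (r, s)" .
  qed
  have pow_mult_E: "(A ^\<^sub>m i) * E f = E ((L ^^ i) f)" for i f
  proof (induction i arbitrary: f)
    case 0
    then show ?case using A EC[of f] by simp
  next
    case (Suc i)
    \<comment> \<open>The factor next to \<open>E f\<close> is split off and changes
      \<open>f\<close> to \<open>L f\<close>, which is why the induction is over arbitrary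
      \<open>f\<close>.\<close>
    have "(A ^\<^sub>m Suc i) * E f = (A ^\<^sub>m i) * (A * E f)"
      using assoc_mult_mat[OF pow_carrier_mat[OF A] A EC] by simp
    then show ?case by (simp add: A_mult_E Suc.IH funpow_swap1)
  qed
  \<comment> \<open>Substituting \<open>a = k - b - c\<close> turns \<open>L\<close> into
    \<open>k\<close> plus the difference operator that defines the next row of
    \<open>x\<close>.\<close>
  have L_x: "L (x i) h = of_nat k * x i h + x (Suc i) h" if "i < d" "0 \<le> h" "h \<le> int d" for i h
  proof -
    have "a h = real k - b h - c h" using cab[of h] that by simp
    then have ah: "of_real (a h) = (of_nat k :: 'a) - of_real (b h) - of_real (c h)" by simp
    show ?thesis using x_rec[of i h] that unfolding L_def ah by (simp add: algebra_simps)
  qed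
  \<comment> \<open>On the rows \<open>x j\<close>, \<open>L\<close> acts as \<open>k\<close> plus
    the shift to row \<open>j + 1\<close>, so its powers expand binomially. The result is the
    formula for the entries of \<open>P\<close>.\<close>
  have L_pow: "(L ^^ i) (x 0) h = (\<Sum>j=0..i. of_nat (i choose j) * of_nat k ^ (i - j) * x j h)"
    if "i \<le> d" "0 \<le> h" "h \<le> int d" for i h
    using that
  proof (induction i arbitrary: h)
    case 0
    then show ?case by simp
  next
    case (Suc i)
    define S where "S h = (\<Sum>j=0..i. of_nat (i choose j) * of_nat k ^ (i - j) * x j h)" for h
    let ?g = "(L ^^ i) (x 0)"
    have IH: "?g h = S h" if "0 \<le> h" "h \<le> int d" for h
      using Suc that by (simp add: S_def)
    \<comment> \<open>The induction hypothesis covers only indices in 0..d. At \<open>h = d\<close>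
      and \<open>h = 0\<close> the neighbour falls outside, but its factor \<open>b (int d)\<close>
      or \<open>c 0\<close> is zero.\<close>
    have "of_real (b h) * ?g (h + 1) = of_real (b h) * S (h + 1)"
      using IH[of "h + 1"] Suc.prems b_bdry(3) by (cases "h = int d") auto
    moreover have "of_real (c h) * ?g (h - 1) = of_real (c h) * S (h - 1)"
      using IH[of "h - 1"] Suc.prems c_bdry(2) by (cases "h = 0") auto
    ultimately have "(L ^^ Suc i) (x 0) h = L S h"
      using IH[of h] Suc.prems by (auto simp: L_def)
    also have "\<dots> = (\<Sum>j=0..i. of_nat (i choose j) * of_nat k ^ (i - j) * L (x j) h)"
      by (simp add: L_def S_def sum_distrib_left sum.distrib algebra_simps)
    also have "\<dots> = (\<Sum>j=0..i. of_nat (i choose j) * of_nat k ^ (i - j) * (of_nat k * x j h + x (Suc j) h))"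
      using Suc.prems by (intro sum.cong refl) (simp add: L_x)
    finally show ?case unfolding sum_binomial_Suc .
  qed
  have pow_mult_X: "((A ^\<^sub>m i) * X) $$ (r, s) = (\<Sum>h\<in>{0..d}. \<alpha> h i * As (int h) $$ (r, s))"
    if "i \<le> d" "r < n" "s < n" for i r s
    using that by (simp add: X_E pow_mult_E index_E L_pow \<alpha>)
  \<comment> \<open>The coefficient of \<open>As h\<close> is the left-hand side of equation
    \<open>h\<close> of the system for \<alpha>, that is, entry \<open>h\<close> of \<open>P\<close>
    applied to \<open>y\<close>.\<close>
  have comb: "finsum_mat n (\<lambda>i. y i \<cdot>\<^sub>m ((A ^\<^sub>m i) * X)) {0..d} $$ (r, s)
      = (\<Sum>h\<in>{0..d}. (\<Sum>i=0..d. \<alpha> h i * y i) * As (int h) $$ (r, s))"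
    if "r < n" "s < n" for y r s
  proof -
    have "finsum_mat n (\<lambda>i. y i \<cdot>\<^sub>m ((A ^\<^sub>m i) * X)) {0..d} $$ (r, s)
      = (\<Sum>i\<in>{0..d}. (y i \<cdot>\<^sub>m ((A ^\<^sub>m i) * X)) $$ (r, s))"
      using A XC that by (intro index_finsum_mat) auto
    also have "\<dots> = (\<Sum>i\<in>{0..d}. y i * ((A ^\<^sub>m i) * X) $$ (r, s))"
      using A XC that by (intro sum.cong refl index_smult_mat) auto
    also have "\<dots> = (\<Sum>i\<in>{0..d}. \<Sum>h\<in>{0..d}. \<alpha> h i * y i * As (int h) $$ (r, s))"
      using that by (intro sum.cong refl) (simp add: pow_mult_X sum_distrib_left ac_simps)
    also have "\<dots> = (\<Sum>h\<in>{0..d}. (\<Sum>i=0..d. \<alpha> h i * y i) * As (int h) $$ (r, s))"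
      by (subst sum.swap) (simp add: sum_distrib_right)
    finally show ?thesis .
  qed
  have combC: "finsum_mat n (\<lambda>i. y i \<cdot>\<^sub>m ((A ^\<^sub>m i) * X)) {0..d} \<in> carrier_mat n n" for y
    using A XC by (intro finsum_mat_carrier) auto
  have finsum_factor: "finsum_mat n (\<lambda>i. y i \<cdot>\<^sub>m ((A ^\<^sub>m i) * X)) {0..d}
      = finsum_mat n (\<lambda>i. y i \<cdot>\<^sub>m (A ^\<^sub>m i)) {0..d} * X" for y
  proof -
    have "(\<lambda>i. y i \<cdot>\<^sub>m ((A ^\<^sub>m i) * X)) = (\<lambda>i. (y i \<cdot>\<^sub>m (A ^\<^sub>m i)) * X)"
      using A XC by (intro ext mult_smult_assoc_mat[symmetric]) auto
    then show ?thesis using A XC by (subst finsum_mat_mult) auto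
  qed

  \<comment> \<open>The factorization of \<open>P\<close> through the unitriangular matrix
    \<open>U\<close>\<close>
  have P_QU: "P = Q * U"
  proof (rule eq_matI)
    show "dim_row P = dim_row (Q * U)" "dim_col P = dim_col (Q * U)" using carriers by auto
    fix h i assume "h < dim_row (Q * U)" "i < dim_col (Q * U)"
    then have hi: "h \<le> d" "i \<le> d" using carriers by auto
    have "(Q * U) $$ (h, i) = (\<Sum>j\<in>{0..<d + 1}. x j (int h) * (of_nat (i choose j) * of_nat k ^ (i - j)))"
      using hi by (simp add: Q U_def scalar_prod_def)
    also have "\<dots> = (\<Sum>j\<in>{0..i}. x j (int h) * (of_nat (i choose j) * of_nat k ^ (i - j)))"
      using hi by (intro sum.mono_neutral_right) (auto simp: not_le)
    also have "\<dots> = P $$ (h, i)" using hi by (simp add: P \<alpha> ac_simps)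
    finally show "P $$ (h, i) = (Q * U) $$ (h, i)" by simp
  qed
  have det_U: "det U = 1" unfolding U_def by (rule det_binomial_mat)
  have det_PQ: "det P = det Q" using P_QU det_mult[OF carriers(2,3)] det_U by simp

  \<comment> \<open>The two linear systems in vector form\<close>
  have system_iff: "((\<Sum>i=0..d. F 0 i * w i) = 1 \<and> (\<forall>h\<in>{1..d}. (\<Sum>i=0..d. F h i * w i) = 0))
      \<longleftrightarrow> mat (d + 1) (d + 1) (\<lambda>(h, i). F h i) *\<^sub>v vec (d + 1) w = unit_vec (d + 1) 0"
    for F :: "nat \<Rightarrow> nat \<Rightarrow> 'a" and w
  proof -
    have "(mat (d + 1) (d + 1) (\<lambda>(h, i). F h i) *\<^sub>v vec (d + 1) w) $ h = (\<Sum>i=0..d. F h i * w i)"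
      if "h < d + 1" for h
      using that by (simp add: scalar_prod_def atLeastLessThanSuc_atLeastAtMost)
    then have "mat (d + 1) (d + 1) (\<lambda>(h, i). F h i) *\<^sub>v vec (d + 1) w = unit_vec (d + 1) 0
      \<longleftrightarrow> (\<forall>h<d + 1. (\<Sum>i=0..d. F h i * w i) = (if h = 0 then 1 else 0))"
      by (auto simp: vec_eq_iff)
    then show ?thesis by (auto simp: less_Suc_eq_le)
  qed
  \<comment> \<open>Solutions are functions on all naturals, of which only the values at 0..d
    matter; this passes to vectors of dimension \<open>d + 1\<close>.\<close>
  have ex_vec: "(\<exists>w. R (vec (d + 1) w)) \<longleftrightarrow> (\<exists>v\<in>carrier_vec (d + 1). R v)" for R :: "'a vec \<Rightarrow> bool"
  proof
    assume "\<exists>v\<in>carrier_vec (d + 1). R v"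
    then obtain v where v: "v \<in> carrier_vec (d + 1)" "R v" by blast
    then have "vec (d + 1) (\<lambda>i. v $ i) = v" by (intro eq_vecI) auto
    with v(2) show "\<exists>w. R (vec (d + 1) w)" by metis
  qed auto
  define e :: "'a vec" where "e = unit_vec (d + 1) 0"
  let ?S1 = "invertible_mat X"
  let ?S2 = "\<exists>y :: nat \<Rightarrow> 'a. finsum_mat n (\<lambda>i. y i \<cdot>\<^sub>m ((A ^\<^sub>m i) * X)) {0..d} = 1\<^sub>m n"
  let ?S3 = "\<exists>y :: nat \<Rightarrow> 'a. (\<Sum>i=0..d. \<alpha> 0 i * y i) = 1 \<and> (\<forall>h\<in>{1..d}. (\<Sum>i=0..d. \<alpha> h i * y i) = 0)"
  let ?S4 = "\<exists>z :: nat \<Rightarrow> 'a. (\<Sum>j=0..d. x j 0 * z j) = 1 \<and> (\<forall>h\<in>{1..d}. (\<Sum>j=0..d. x j (int h) * z j) = 0)"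
  have S3_iff: "?S3 \<longleftrightarrow> (\<exists>y\<in>carrier_vec (d + 1). P *\<^sub>v y = e)"
    unfolding system_iff P[symmetric] e_def[symmetric] by (rule ex_vec)
  have S4_iff: "?S4 \<longleftrightarrow> (\<exists>z\<in>carrier_vec (d + 1). Q *\<^sub>v z = e)"
    \<comment> \<open>The instance of \<open>system_iff\<close> has \<open>x j (int 0)\<close> in
      its first equation; \<open>of_nat_0\<close> brings it to the form \<open>x j 0\<close> of the
      goal.\<close>
    using ex_vec[of "\<lambda>z. Q *\<^sub>v z = e"]
      system_iff[of "\<lambda>h j. x j (int h)", unfolded Q[symmetric] e_def[symmetric] of_nat_0]
    by (simp only:)

  \<comment> \<open>The implications below run from \<open>?S1\<close> to \<open>det P\<close>
    nonzero, from \<open>det Q\<close> nonzero to \<open>?S4\<close>, then to \<open>?S3\<close>,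
    \<open>?S2\<close> and back to \<open>?S1\<close>. Equality of the two determinants closes the
    cycle, and the invertibility of \<open>P\<close> and \<open>Q\<close> joins through the
    determinant criterion.\<close>
  have "?S1 \<Longrightarrow> det P \<noteq> 0"
  proof
    assume X_inv: ?S1 and "det P = 0"
    then obtain v where v: "v \<in> carrier_vec (d + 1)" "v \<noteq> 0\<^sub>v (d + 1)" "P *\<^sub>v v = 0\<^sub>v (d + 1)"
      using det_0_iff_vec_prod_zero_field[OF carriers(1)] by auto
    \<comment> \<open>The kernel vector of \<open>P\<close> read as the coefficients of a polynomial
      in \<open>A\<close>. All coefficients of \<open>M * X\<close> in the \<open>As h\<close> are
      then zero, and cancelling \<open>X\<close> on the right gives \<open>M = 0\<close>.\<close>
    define M where "M = finsum_mat n (\<lambda>i. v $ i \<cdot>\<^sub>m (A ^\<^sub>m i)) {0..d}"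
    have MC: "M \<in> carrier_mat n n" unfolding M_def using A by (intro finsum_mat_carrier) auto
    have Pv: "(\<Sum>i=0..d. \<alpha> h i * v $ i) = 0" if "h \<in> {0..d}" for h
    proof -
      have "(P *\<^sub>v v) $ h = (\<Sum>i=0..d. \<alpha> h i * v $ i)"
        using v(1) that by (simp add: P scalar_prod_def atLeastLessThanSuc_atLeastAtMost)
      then show ?thesis using v(3) that by simp
    qed
    have "M * X = 0\<^sub>m n n"
    proof (rule eq_matI)
      fix r s assume "r < dim_row (0\<^sub>m n n :: 'a mat)" "s < dim_col (0\<^sub>m n n :: 'a mat)"
      then show "(M * X) $$ (r, s) = 0\<^sub>m n n $$ (r, s)"
        unfolding M_def finsum_factor[symmetric] by (simp add: comb Pv)
    qed (use MC XC in auto)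
    moreover obtain Y where Y: "Y \<in> carrier_mat n n" "X * Y = 1\<^sub>m n"
      using X_inv XC by (rule invertible_mat_right_inverse)
    moreover have "M = (M * X) * Y" using assoc_mult_mat[OF MC XC Y(1)] Y(2) MC by simp
    ultimately have "M = 0\<^sub>m n n" by simp
    then have "v $ i = 0" if "i \<le> d" for i
      using min_poly_degree_independent[OF A A_min_poly, of "\<lambda>i. v $ i" i] that by (simp add: M_def)
    then have "v = 0\<^sub>v (d + 1)" using v(1) by (intro eq_vecI) auto
    with v(2) show False by simp
  qed
  moreover have "det Q \<noteq> 0 \<Longrightarrow> ?S4"
  proof -
    assume "det Q \<noteq> 0"
    then obtain R where R: "R \<in> carrier_mat (d + 1) (d + 1)" "Q * R = 1\<^sub>m (d + 1)"
      using invertible_mat_iff_det[OF carriers(2)] carriers(2) by (metis invertible_mat_right_inverse)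
    have "Q *\<^sub>v (R *\<^sub>v e) = e"
      using assoc_mult_mat_vec[OF carriers(2) R(1), of e] R(2) by (simp add: e_def)
    moreover have "R *\<^sub>v e \<in> carrier_vec (d + 1)" using R(1) by (simp add: e_def)
    ultimately show ?S4 unfolding S4_iff by blast
  qed
  moreover have "?S3 \<longleftrightarrow> ?S4"
  proof -
    \<comment> \<open>With \<open>V\<close> the inverse of \<open>U\<close>,
      \<open>Q = P * V\<close>. Hence \<open>V\<close> carries solutions of the system for
      \<open>Q\<close> to solutions of the system for \<open>P\<close>, and \<open>U\<close> carries
      them back.\<close>
    obtain V where V: "V \<in> carrier_mat (d + 1) (d + 1)" "U * V = 1\<^sub>m (d + 1)"
      using invertible_mat_iff_det[OF carriers(3)] det_U carriers(3)
      by (metis invertible_mat_right_inverse zero_neq_one)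
    have "Q *\<^sub>v z = P *\<^sub>v (V *\<^sub>v z)" if z: "z \<in> carrier_vec (d + 1)" for z
    proof -
      have "Q *\<^sub>v z = Q *\<^sub>v ((U * V) *\<^sub>v z)" using z V(2) by simp
      also have "\<dots> = Q *\<^sub>v (U *\<^sub>v (V *\<^sub>v z))"
        using assoc_mult_mat_vec[OF carriers(3) V(1) z] by simp
      also have "\<dots> = P *\<^sub>v (V *\<^sub>v z)"
        unfolding P_QU using assoc_mult_mat_vec[OF carriers(2,3)] V(1) z by simp
      finally show ?thesis .
    qed
    moreover have "P *\<^sub>v y = Q *\<^sub>v (U *\<^sub>v y)" if "y \<in> carrier_vec (d + 1)" for y
      unfolding P_QU using assoc_mult_mat_vec[OF carriers(2,3) that] .
    moreover have "V *\<^sub>v z \<in> carrier_vec (d + 1)" "U *\<^sub>v z \<in> carrier_vec (d + 1)"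
      if "z \<in> carrier_vec (d + 1)" for z
      using that V(1) carriers(3) by auto
    ultimately show ?thesis unfolding S3_iff S4_iff by metis
  qed
  moreover have "?S3 \<Longrightarrow> ?S2"
  proof -
    assume ?S3
    then obtain y where y: "(\<Sum>i=0..d. \<alpha> 0 i * y i) = 1" "\<And>h. h \<in> {1..d} \<Longrightarrow> (\<Sum>i=0..d. \<alpha> h i * y i) = 0"
      by blast
    have "finsum_mat n (\<lambda>i. y i \<cdot>\<^sub>m ((A ^\<^sub>m i) * X)) {0..d} = 1\<^sub>m n"
    proof (rule eq_matI)
      fix r s assume "r < dim_row (1\<^sub>m n :: 'a mat)" "s < dim_col (1\<^sub>m n :: 'a mat)"
      then have rs: "r < n" "s < n" by auto
      \<comment> \<open>The system says that the coefficients are 1 at \<open>h = 0\<close> and 0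
        elsewhere, so only \<open>As 0\<close>, the identity, survives.\<close>
      have "finsum_mat n (\<lambda>i. y i \<cdot>\<^sub>m ((A ^\<^sub>m i) * X)) {0..d} $$ (r, s)
        = (\<Sum>h\<in>{0..d}. (if h = 0 then 1 else 0) * As (int h) $$ (r, s))"
        unfolding comb[OF rs] using y by (intro sum.cong refl) auto
      also have "\<dots> = (\<Sum>h\<in>{0..d}. if h = 0 then As (int h) $$ (r, s) else 0)"
        by (intro sum.cong) auto
      also have "\<dots> = 1\<^sub>m n $$ (r, s)" by (simp add: As_bdry)
      finally show "finsum_mat n (\<lambda>i. y i \<cdot>\<^sub>m ((A ^\<^sub>m i) * X)) {0..d} $$ (r, s) = 1\<^sub>m n $$ (r, s)" .
    qed (use combC in auto)
    then show ?S2 by blast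
  qed
  moreover have "?S2 \<Longrightarrow> ?S1"
  proof -
    assume ?S2
    then obtain y where y: "finsum_mat n (\<lambda>i. y i \<cdot>\<^sub>m (A ^\<^sub>m i)) {0..d} * X = 1\<^sub>m n"
      (is "?Y * X = _") unfolding finsum_factor by blast
    have "?Y \<in> carrier_mat n n" using A by (intro finsum_mat_carrier) auto
    \<comment> \<open>Only a left inverse of \<open>X\<close> is at hand; determinants turn it into
      invertibility.\<close>
    then have "det ?Y * det X = 1" using det_mult[of ?Y n X] XC y by simp
    then have "det X \<noteq> 0" by auto
    then show ?S1 using invertible_mat_iff_det[OF XC] by blast
  qed
  ultimately show ?thesis
    unfolding all_equivalent_def using det_PQ invertible_mat_iff_det[OF carriers(1)]
      invertible_mat_iff_det[OF carriers(2)] by (simp only: list.set ball_simps) blast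
qed

end
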